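(* For every $R>0$, $$\int_{\mathcal{C}_R} |\nabla u|^2 \,dx \;\geq\; \frac{(d-2)^2}{4\pi R\sqrt{d}\,\coth(\pi R \sqrt{d})} \int_{\mathcal{C}_R} V u^2 \,dx, \qquad \forall u \in C_0^\infty \Big(\mathcal{C}_R\setminus\bigcup_{k\in\mathbb{Z}} \{a_k\}\Big).$$
   Context: Let $d\ge 1$ be the dimension and let $h>0$ be fixed by $dh=1$. Set $a_k:=(kh,\ldots,kh)\in\mathbb{R}^d$ for $k\in\mathbb{Z}$ (the singular poles), and define the potential $$V(x)=\sum_{k\in\mathbb{Z}}\frac{1}{|x-a_k|^2},\qquad x\in\mathbb{R}^d\setminus\bigcup_{k\in\mathbb{Z}}\{a_k\}.$$ Let $\gamma=\{(t,\ldots,t):t\in\mathbb{R}\}\subset\mathbb{R}^d$ be the line $x_1=x_2=\cdots=x_d$. For $R>0$, $\mathcal{C}_R$ denotes the (infinite) right circular cylinder of radius $R$ with axis $\gamma$, i.e. the set of points at distance at most $R$ from $\gamma$. $C_0^\infty(\mathcal{C}_R\setminus\bigcup_k\{a_k\})$ denotes the real-valued smooth functions with compact support contained in the interior of $\mathcal{C}_R$ minus the poles. *)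

theory Defs
  imports "HOL-Analysis.Analysis"
begin

text \<open>The ambient space is \<open>real ^ 'n\<close>, of dimension \<open>d = CARD('n)\<close>, which is positive for every
  finite index type.\<close>

definition coth :: "real \<Rightarrow> real" where
  "coth x = cosh x / sinh x"

definition pole :: "real \<Rightarrow> int \<Rightarrow> real ^ 'n" where
  "pole h k = (\<chi> i. of_int k * h)"

text \<open>For \<open>h > 0\<close> the family is summable at every \<open>x\<close>. The value at a pole is immaterial
  (there the singular term is \<open>1 / 0 = 0\<close>).\<close>
definition potential :: "real \<Rightarrow> real ^ 'n \<Rightarrow> real" where
  "potential h x = (\<Sum>\<^sub>\<infinity>k\<in>UNIV. 1 / (norm (x - pole h k))\<^sup>2)"

definition diagonal :: "(real ^ 'n) set" where
  "diagonal = range (\<lambda>t. \<chi> i. t)"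

definition cylinder :: "real \<Rightarrow> (real ^ 'n) set" where
  "cylinder R = {x. infdist x diagonal \<le> R}"

definition grad :: "(real ^ 'n \<Rightarrow> real) \<Rightarrow> real ^ 'n \<Rightarrow> real ^ 'n" where
  "grad u x = (\<chi> i. frechet_derivative u (at x) (axis i 1))"

text \<open>\<open>times_differentiable m u\<close>: all iterated directional derivatives of \<open>u\<close> of order less than
  \<open>m\<close> are Frechet differentiable everywhere, and those of order \<open>m\<close> are continuous,
  i.e. \<open>u\<close> is of class \<open>C\<close>-\<open>m\<close>.\<close>
fun times_differentiable :: "nat \<Rightarrow> (real ^ 'n \<Rightarrow> real) \<Rightarrow> bool" where
  "times_differentiable 0 u \<longleftrightarrow> continuous_on UNIV u"
| "times_differentiable (Suc m) u \<longleftrightarrow>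
     (\<forall>x. u differentiable (at x)) \<and>
     (\<forall>v. times_differentiable m (\<lambda>x. frechet_derivative u (at x) v))"

definition smooth :: "(real ^ 'n \<Rightarrow> real) \<Rightarrow> bool" where
  "smooth u \<longleftrightarrow> (\<forall>m. times_differentiable m u)"

text \<open>Test functions on an open set \<open>\<Omega>\<close>, identified with their extensions by zero to the
  whole space.\<close>
definition test_functions :: "(real ^ 'n) set \<Rightarrow> (real ^ 'n \<Rightarrow> real) set" where
  "test_functions \<Omega> = {u. smooth u \<and> compact (closure {x. u x \<noteq> 0}) \<and> closure {x. u x \<noteq> 0} \<subseteq> \<Omega>}"

end

theory Submission
  imports Defs
begin

text \<open>
  Let \<open>d\<close> be the dimension and \<open>a\<^sub>k\<close> the \<open>k\<close>-th pole. For a vector field \<open>F\<close> that is regular on the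
  support of \<open>u\<close>, expanding \<open>(norm (grad u + u F))\<^sup>2 \<ge> 0\<close> and integrating by parts gives
  \<open>\<integral> (norm (grad u))\<^sup>2 \<ge> \<integral> u\<^sup>2 (div F - (norm F)\<^sup>2)\<close>. Take
  \<open>F = \<alpha> * (\<Sum>k. (x - a\<^sub>k) / (norm (x - a\<^sub>k))\<^sup>2)\<close>, that is \<open>\<alpha>\<close> times the regularized gradient of
  \<open>\<Sum>k. ln (norm (x - a\<^sub>k))\<close>. Then \<open>div F = \<alpha> * (d - 2) * V\<close>, so the theorem follows from a bound
  \<open>(norm F)\<^sup>2 \<le> \<alpha>\<^sup>2 * \<kappa> * V\<close> on the cylinder by choosing \<open>\<alpha> = (d - 2) / (2 * \<kappa>)\<close>; the resulting constant is
  \<open>(d - 2)\<^sup>2 / (4 * \<kappa>)\<close>, and \<open>\<kappa>\<close> has to be \<open>\<pi> * R * sqrt d * coth (\<pi> * R * sqrt d)\<close>.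

  This bound is a statement about the cotangent. The point \<open>x\<close> and the poles lie in one plane, and the
  complex coordinate \<open>z\<close> on it (\<open>axial_coord\<close>) with real part \<open>sqrt d\<close> times the coordinate along the
  axis and imaginary part \<open>sqrt d\<close> times the distance to the axis turns the poles into the integers.
  Then \<open>V = d * (\<Sum>k. 1 / (norm (z - k))\<^sup>2)\<close> and \<open>norm F = \<bar>\<alpha>\<bar> * sqrt d * norm (\<Sum>k. 1 / (z - k))\<close>,
  and the last sum is \<open>\<pi> * cot (\<pi> * z)\<close> (\<open>cot_partial_fractions\<close>, from the reflection formula for
  the Gamma function). The imaginary part of the same expansion evaluates \<open>V\<close> off the axis
  (\<open>Im_mult_lattice_sum\<close>), and elementary formulas for the cotangent give the bound
  (\<open>pi_cot_sq_le_lattice_sum\<close>); points on the axis are limits of points off it.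

  The integration by parts is carried out for finitely many poles
  (\<open>integral_divergence_multipole_field\<close>), followed by dominated convergence. The domination
  (\<open>lattice_sum_bounded_on_compact\<close>, \<open>norm_cot_partial_sum_le\<close>) uses that the support of \<open>u\<close> is compact
  and avoids the poles.
\<close>

section \<open>The cotangent and the lattice sum\<close>

lemma summable_on_int_inverse_square:
  "(\<lambda>k::int. 1 / (1 + (real_of_int k)\<^sup>2)) summable_on UNIV"
proof -
  let ?f = "\<lambda>k::int. 1 / (1 + (real_of_int k)\<^sup>2)"
  have nat: "(\<lambda>n::nat. 1 / (1 + (real n)\<^sup>2)) summable_on UNIV"
  proof -
    have "summable (\<lambda>n::nat. 1 / (1 + (real n)\<^sup>2))"
    proof (rule summable_comparison_test)
      show "summable (\<lambda>n::nat. inverse ((real n)\<^sup>2))"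
        by (rule inverse_power_summable) simp
      show "\<exists>N. \<forall>n\<ge>N. norm (1 / (1 + (real n)\<^sup>2)) \<le> inverse ((real n)\<^sup>2)"
        by (intro exI[of _ 1] allI impI) (simp add: inverse_eq_divide divide_left_mono add_pos_pos)
    qed
    then show ?thesis
      by (subst summable_on_UNIV_nonneg_real_iff) auto
  qed
  have "?f summable_on range int"
    using nat by (subst summable_on_reindex) (auto simp: o_def)
  moreover have "?f summable_on range (\<lambda>n. - int n)"
    using nat by (subst summable_on_reindex) (auto simp: o_def inj_on_def)
  ultimately have "?f summable_on range int \<union> range (\<lambda>n. - int n)"
    by (rule summable_on_union)
  moreover have "range int \<union> range (\<lambda>n. - int n) = UNIV"
    by (auto intro: int_cases2)
  ultimately show ?thesis by simp
qed

text \<open>A summable majorant that is uniform on bounded sets of \<open>z\<close> staying at distance \<open>\<delta>\<close> from the integers.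
  It rests on \<open>1 + k\<^sup>2 \<le> (1 + 2 * B\<^sup>2) + 2 * (norm (z - k))\<^sup>2\<close>.\<close>
lemma inverse_square_dist_of_int_le:
  fixes z :: complex and k :: int
  assumes "norm z \<le> B" "0 < \<delta>" "\<delta> \<le> norm (z - of_int k)"
  shows "1 / (norm (z - of_int k))\<^sup>2 \<le> (2 + (1 + 2 * B\<^sup>2) / \<delta>\<^sup>2) * (1 / (1 + (real_of_int k)\<^sup>2))"
proof -
  let ?n = "norm (z - of_int k)"
  have "\<bar>real_of_int k\<bar> \<le> ?n + B"
    using norm_triangle_ineq2[of "of_int k :: complex" z] assms(1) by (simp add: norm_minus_commute)
  then have "(real_of_int k)\<^sup>2 \<le> (?n + B)\<^sup>2"
    by (metis abs_ge_zero power2_abs power_mono)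
  also have "\<dots> \<le> 2 * ?n\<^sup>2 + 2 * B\<^sup>2"
    using zero_le_power2[of "?n - B"] by (simp add: power2_sum power2_diff)
  finally have 1: "1 + (real_of_int k)\<^sup>2 \<le> (1 + 2 * B\<^sup>2) + 2 * ?n\<^sup>2" by simp
  have "\<delta>\<^sup>2 \<le> ?n\<^sup>2"
    using assms by (intro power_mono) auto
  then have "(1 + 2 * B\<^sup>2) * \<delta>\<^sup>2 \<le> (1 + 2 * B\<^sup>2) * ?n\<^sup>2"
    by (intro mult_left_mono) auto
  then have "1 + 2 * B\<^sup>2 \<le> (1 + 2 * B\<^sup>2) / \<delta>\<^sup>2 * ?n\<^sup>2"
    using assms(2) by (simp add: field_simps)
  with 1 have 2: "1 + (real_of_int k)\<^sup>2 \<le> (2 + (1 + 2 * B\<^sup>2) / \<delta>\<^sup>2) * ?n\<^sup>2"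
    by (simp add: algebra_simps)
  have "0 < ?n\<^sup>2" using assms by auto
  moreover have "0 < 1 + (real_of_int k)\<^sup>2"
    by (simp add: add_pos_nonneg)
  ultimately show ?thesis using 2 by (simp add: divide_simps)
qed

lemma dist_Ints_pos:
  fixes z :: complex
  assumes "z \<notin> \<int>"
  obtains \<delta> where "0 < \<delta>" "\<And>k::int. \<delta> \<le> norm (z - of_int k)"
proof -
  have "open (- (\<int> :: complex set))" by (simp add: open_Compl)
  then obtain \<delta> where "0 < \<delta>" "ball z \<delta> \<subseteq> - \<int>"
    using assms by (metis ComplI open_contains_ball)
  then show ?thesis
    by (intro that[of \<delta>]) (auto simp: dist_norm subset_iff not_less[symmetric])
qed

text \<open>Up to the factor \<open>d\<close>, the potential in the complex coordinate: the sum of the inverse squared distances from \<open>z\<close> to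
  all integers, meaningful for \<open>z \<notin> \<int>\<close>.\<close>
definition lattice_sum :: "complex \<Rightarrow> real" where
  "lattice_sum z = (\<Sum>\<^sub>\<infinity>k::int. 1 / (norm (z - of_int k))\<^sup>2)"

lemma summable_lattice_sum:
  fixes z :: complex
  assumes "z \<notin> \<int>"
  shows "(\<lambda>k::int. 1 / (norm (z - of_int k))\<^sup>2) summable_on UNIV"
proof -
  obtain \<delta> where d: "0 < \<delta>" "\<And>k::int. \<delta> \<le> norm (z - of_int k)"
    using dist_Ints_pos[OF assms] by blast
  show ?thesis
  proof (rule summable_on_comparison_test)
    show "(\<lambda>k::int. (2 + (1 + 2 * (norm z)\<^sup>2) / \<delta>\<^sup>2) * (1 / (1 + (real_of_int k)\<^sup>2))) summable_on UNIV"
      by (intro summable_on_cmult_right summable_on_int_inverse_square)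
  qed (use inverse_square_dist_of_int_le[OF order_refl d] in auto)
qed

lemma lattice_sum_bound:
  assumes "0 < \<delta>"
  obtains C where "\<And>z. norm z \<le> B \<Longrightarrow> (\<And>k::int. \<delta> \<le> norm (z - of_int k)) \<Longrightarrow> lattice_sum z \<le> C"
proof
  fix z :: complex
  assume z: "norm z \<le> B" "\<And>k::int. \<delta> \<le> norm (z - of_int k)"
  have "z \<notin> \<int>" using z(2) assms by (metis Ints_cases diff_self leD norm_zero)
  then show "lattice_sum z \<le> (\<Sum>\<^sub>\<infinity>k::int. (2 + (1 + 2 * B\<^sup>2) / \<delta>\<^sup>2) * (1 / (1 + (real_of_int k)\<^sup>2)))"
    unfolding lattice_sum_def using z assms
    by (intro infsum_mono summable_lattice_sum summable_on_cmult_right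
        summable_on_int_inverse_square inverse_square_dist_of_int_le) auto
qed

text \<open>The intervals \<open>{1 - m..m}\<close> exhaust the integers. They are not symmetric about \<open>0\<close>: they are
  symmetric about \<open>1/2\<close>, which is the shape that the reflection \<open>z \<mapsto> 1 - z\<close> of the Digamma
  function produces.\<close>
lemma filterlim_int_intervals:
  "filterlim (\<lambda>m. {1 - int m..int m}) (finite_subsets_at_top UNIV) sequentially"
  unfolding filterlim_finite_subsets_at_top
proof safe
  fix X :: "int set" assume "finite X"
  define N where "N = (\<Sum>k\<in>X. \<bar>k\<bar>)"
  have N: "\<bar>k\<bar> \<le> N" if "k \<in> X" for k
    unfolding N_def using \<open>finite X\<close> that by (intro member_le_sum) auto
  show "\<forall>\<^sub>F m in sequentially. finite {1 - int m..int m} \<and> X \<subseteq> {1 - int m..int m} \<and> {1 - int m..int m} \<subseteq> UNIV"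
    using eventually_ge_at_top[of "nat (N + 1)"]
  proof eventually_elim
    case (elim m)
    then show ?case using N by force
  qed
qed

lemma lattice_sum_limit:
  assumes "z \<notin> \<int>"
  shows "(\<lambda>m. \<Sum>k\<in>{1 - int m..int m}. 1 / (norm (z - of_int k))\<^sup>2) \<longlonglongrightarrow> lattice_sum z"
  using has_sum_infsum[OF summable_lattice_sum[OF assms]] filterlim_int_intervals
  unfolding has_sum_def lattice_sum_def by (rule filterlim_compose)

lemma sum_le_lattice_sum:
  assumes "z \<notin> \<int>" "finite A"
  shows "(\<Sum>k\<in>A. 1 / (norm (z - of_int k))\<^sup>2) \<le> lattice_sum z"
  unfolding lattice_sum_def using assms
  by (intro finite_sum_le_infsum summable_lattice_sum) auto

lemma sum_int_interval_pair:
  fixes f :: "int \<Rightarrow> 'a::comm_monoid_add"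
  shows "(\<Sum>k\<in>{1 - int m..int m}. f k) = (\<Sum>n<m. f (- int n)) + (\<Sum>n<m. f (int n + 1))"
proof (induction m)
  case (Suc m)
  have "{1 - int (Suc m)..int (Suc m)} = insert (- int m) (insert (int m + 1) {1 - int m..int m})"
    by auto
  then have "(\<Sum>k\<in>{1 - int (Suc m)..int (Suc m)}. f k) = f (- int m) + (f (int m + 1) + (\<Sum>k\<in>{1 - int m..int m}. f k))"
    by simp
  then show ?case using Suc by (simp add: ac_simps)
qed simp

text \<open>The logarithmic derivative of \<open>\<Gamma>(z) \<Gamma>(1 - z) = \<pi> / sin (\<pi> z)\<close>.\<close>
lemma Digamma_reflection:
  fixes z :: complex
  assumes "z \<notin> \<int>"
  shows "Digamma (1 - z) - Digamma z = of_real pi * cot (of_real pi * z)"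
proof -
  have z': "1 - z \<notin> \<int>" using assms
    using Ints_diff[OF Ints_1, of "1 - z"] by auto
  have nz: "z \<notin> \<int>\<^sub>\<le>\<^sub>0" "1 - z \<notin> \<int>\<^sub>\<le>\<^sub>0"
    using assms z' nonpos_Ints_subset_Ints by blast+
  have s0: "sin (of_real pi * z) \<noteq> 0"
    using assms by (auto simp: sin_eq_0)
  have "((\<lambda>w. rGamma w * rGamma (1 - w)) has_field_derivative
      (- rGamma z * Digamma z) * rGamma (1 - z) + rGamma z * (rGamma (1 - z) * Digamma (1 - z))) (at z)"
    using nz by (auto intro!: derivative_eq_intros)
  moreover have "((\<lambda>w. rGamma w * rGamma (1 - w)) has_field_derivative cos (of_real pi * z)) (at z)"
    unfolding rGamma_reflection_complex by (auto intro!: derivative_eq_intros)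
  ultimately have "rGamma z * rGamma (1 - z) * (Digamma (1 - z) - Digamma z) = cos (of_real pi * z)"
    by (auto dest: DERIV_unique simp: algebra_simps)
  then show ?thesis
    using s0 unfolding rGamma_reflection_complex cot_def by (simp add: field_simps)
qed

text \<open>Euler's partial fraction expansion of the cotangent: subtracting the limit formulas for
  \<open>Digamma\<close> at \<open>z\<close> and \<open>1 - z\<close> cancels the logarithms.\<close>
lemma cot_partial_fractions:
  fixes z :: complex
  assumes "z \<notin> \<int>"
  shows "(\<lambda>m. \<Sum>k\<in>{1 - int m..int m}. 1 / (z - of_int k)) \<longlonglongrightarrow> of_real pi * cot (of_real pi * z)"
proof -
  have "z \<noteq> 0" "1 - z \<noteq> 0" using assms by auto
  then have "(\<lambda>m. (of_real (ln (real m)) - (\<Sum>n<m. inverse ((1 - z) + of_nat n)))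
      - (of_real (ln (real m)) - (\<Sum>n<m. inverse (z + of_nat n)))) \<longlonglongrightarrow> Digamma (1 - z) - Digamma z"
    by (intro tendsto_diff Digamma_LIMSEQ)
  moreover have "(of_real (ln (real m)) - (\<Sum>n<m. inverse ((1 - z) + of_nat n)))
      - (of_real (ln (real m)) - (\<Sum>n<m. inverse (z + of_nat n))) = (\<Sum>k\<in>{1 - int m..int m}. 1 / (z - of_int k))" for m
  proof -
    have "1 / (z - of_int (int n + 1)) = - inverse ((1 - z) + of_nat n)" for n
    proof -
      have "z - of_int (int n + 1) = - ((1 - z) + of_nat n)" by simp
      then show ?thesis by (metis inverse_eq_divide inverse_minus_eq)
    qed
    then show ?thesis
      by (simp add: sum_int_interval_pair sum_negf inverse_eq_divide del: of_int_add)
  qed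
  ultimately show ?thesis using Digamma_reflection[OF assms] by simp
qed

text \<open>The terms \<open>k = -n\<close> and \<open>k = n + 1\<close> combine to \<open>(2 * z - 1) / ((z + n) * (z - n - 1))\<close>, so the
  conditionally convergent sum is controlled by the absolutely convergent one, uniformly in \<open>m\<close>.\<close>
lemma norm_cot_partial_sum_le:
  fixes z :: complex
  assumes "z \<notin> \<int>"
  shows "norm (\<Sum>k\<in>{1 - int m..int m}. 1 / (z - of_int k)) \<le> (norm z + 1) * lattice_sum z"
proof -
  have nz: "z - of_int k \<noteq> 0" for k using assms by auto
  let ?a = "\<lambda>k::int. norm (1 / (z - of_int k))"
  have pair: "norm (1 / (z - of_int (- int n)) + 1 / (z - of_int (int n + 1)))
      \<le> (norm z + 1) * ((?a (- int n))\<^sup>2 + (?a (int n + 1))\<^sup>2)" for n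
  proof -
    let ?u = "1 / (z - of_int (- int n))" and ?v = "1 / (z - of_int (int n + 1))"
    have "?u + ?v = (2 * z - 1) * (?u * ?v)"
      using nz[of "- int n"] nz[of "int n + 1"] by (simp add: field_simps)
    then have "norm (?u + ?v) = norm (2 * z - 1) * (norm ?u * norm ?v)"
      by (metis norm_mult)
    also have "\<dots> \<le> (2 * (norm z + 1)) * (((norm ?u)\<^sup>2 + (norm ?v)\<^sup>2) / 2)"
    proof (rule mult_mono)
      show "norm (2 * z - 1) \<le> 2 * (norm z + 1)"
        using norm_triangle_ineq4[of "2 * z" 1] by (simp add: norm_mult)
      show "norm ?u * norm ?v \<le> ((norm ?u)\<^sup>2 + (norm ?v)\<^sup>2) / 2"
        using zero_le_power2[of "norm ?u - norm ?v"] by (simp add: power2_diff)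
    qed auto
    also have "\<dots> = (norm z + 1) * ((norm ?u)\<^sup>2 + (norm ?v)\<^sup>2)"
      by (simp only: times_divide_eq_right mult.assoc)
    finally show ?thesis .
  qed
  have "norm (\<Sum>k\<in>{1 - int m..int m}. 1 / (z - of_int k))
      = norm (\<Sum>n<m. 1 / (z - of_int (- int n)) + 1 / (z - of_int (int n + 1)))"
    by (simp only: sum_int_interval_pair sum.distrib)
  also have "\<dots> \<le> (\<Sum>n<m. (norm z + 1) * ((?a (- int n))\<^sup>2 + (?a (int n + 1))\<^sup>2))"
    by (intro sum_norm_le pair)
  also have "\<dots> = (norm z + 1) * (\<Sum>k\<in>{1 - int m..int m}. (?a k)\<^sup>2)"
    by (simp only: sum_int_interval_pair sum.distrib[symmetric] sum_distrib_left[symmetric])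
  also have "\<dots> = (norm z + 1) * (\<Sum>k\<in>{1 - int m..int m}. 1 / (norm (z - of_int k))\<^sup>2)"
    by (simp add: norm_divide power_divide)
  also have "\<dots> \<le> (norm z + 1) * lattice_sum z"
    using assms by (intro mult_left_mono sum_le_lattice_sum) auto
  finally show ?thesis .
qed

text \<open>Since \<open>Im (1 / (z - k)) = - Im z / (norm (z - k))\<^sup>2\<close>, the imaginary part of the cotangent expansion
  sums the potential.\<close>
lemma Im_mult_lattice_sum:
  assumes "z \<notin> \<int>"
  shows "Im z * lattice_sum z = - Im (of_real pi * cot (of_real pi * z))"
proof -
  have "Im (1 / (z - of_int k)) = - (Im z * (1 / (norm (z - of_int k))\<^sup>2))" for k
    by (simp add: Im_divide cmod_power2)
  then have "(\<lambda>m. - (Im z * (\<Sum>k\<in>{1 - int m..int m}. 1 / (norm (z - of_int k))\<^sup>2))) \<longlonglongrightarrow> Im (of_real pi * cot (of_real pi * z))"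
    using tendsto_Im[OF cot_partial_fractions[OF assms]]
    by (simp add: sum_negf sum_distrib_left)
  moreover have "(\<lambda>m. - (Im z * (\<Sum>k\<in>{1 - int m..int m}. 1 / (norm (z - of_int k))\<^sup>2))) \<longlonglongrightarrow> - (Im z * lattice_sum z)"
    by (intro tendsto_minus tendsto_mult tendsto_const lattice_sum_limit assms)
  ultimately show ?thesis
    using LIMSEQ_unique by fastforce
qed

lemma mult_coth_mono:
  assumes "0 < x" "x \<le> y"
  shows "x * coth x \<le> y * coth y"
proof (rule DERIV_nonneg_imp_nondecreasing[OF assms(2)])
  fix t assume t: "x \<le> t" "t \<le> y"
  then have "t > 0" using assms by simp
  then have s: "sinh t > 0" by simp
  have "t \<le> sinh t"
    using \<open>t > 0\<close> real_le_x_sinh[of t] by (simp add: sinh_def exp_minus)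
  also have "\<dots> \<le> sinh t * cosh t"
    using s cosh_real_ge_1[of t] by simp
  finally have "0 \<le> (sinh t * cosh t - t) / (sinh t)\<^sup>2" by simp
  moreover have "((\<lambda>x. x * coth x) has_real_derivative (sinh t * cosh t - t) / (sinh t)\<^sup>2) (at t)"
    unfolding coth_def using s
    by (auto intro!: derivative_eq_intros simp: field_simps power2_eq_square)
      (use cosh_square_eq[of t] in \<open>simp add: power2_eq_square algebra_simps\<close>)
  ultimately show "\<exists>D. ((\<lambda>x. x * coth x) has_real_derivative D) (at t) \<and> 0 \<le> D" by blast
qed

text \<open>With \<open>w = a + \<i> b\<close>, \<open>b > 0\<close> and \<open>N = (norm (sin w))\<^sup>2\<close> one has \<open>- Im (cot w) = sinh b * cosh b / N\<close> and
  \<open>(norm (cot w))\<^sup>2 \<le> (cosh b)\<^sup>2 / N\<close>. Hence \<open>(norm (cot w))\<^sup>2\<close> is at most \<open>coth b\<close> times \<open>- Im (cot w)\<close>, and \<open>b * coth b\<close> increases.\<close>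
lemma norm_cot_sq_le:
  fixes w :: complex
  assumes "0 < Im w" "Im w \<le> Y"
  shows "Im w * (norm (cot w))\<^sup>2 \<le> Y * coth Y * (- Im (cot w))"
proof -
  define a where "a = Re w"
  define b where "b = Im w"
  have b: "0 < b" using assms b_def by simp
  have s: "0 < sinh b" using b by simp
  have sn: "Re (sin w) = sin a * cosh b" "Im (sin w) = cos a * sinh b"
       "Re (cos w) = cos a * cosh b" "Im (cos w) = - (sin a * sinh b)"
    by (simp_all add: Re_sin Im_sin Re_cos Im_cos a_def b_def cosh_def sinh_def field_simps)
  define N where "N = (norm (sin w))\<^sup>2"
  have sc: "(sin a)\<^sup>2 = 1 - (cos a)\<^sup>2" "(cosh b)\<^sup>2 = 1 + (sinh b)\<^sup>2"
    using sin_squared_eq[of a] cosh_square_eq[of b] by auto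
  have N: "N = (sinh b)\<^sup>2 + (sin a)\<^sup>2"
    unfolding N_def cmod_power2 sn power_mult_distrib sc by (simp add: algebra_simps)
  have N0: "0 < N" unfolding N using s by (simp add: add_pos_nonneg)
  have im: "- Im (cot w) = sinh b * cosh b / N"
  proof -
    have "Im (cos w / sin w) = (Im (cos w) * Re (sin w) - Re (cos w) * Im (sin w)) / N"
      by (simp add: Im_divide N_def cmod_power2)
    also have "Im (cos w) * Re (sin w) - Re (cos w) * Im (sin w)
        = - (((sin a)\<^sup>2 + (cos a)\<^sup>2) * (sinh b * cosh b))"
      unfolding sn by algebra
    finally show ?thesis unfolding cot_def by simp
  qed
  have nm: "(norm (cot w))\<^sup>2 = ((sinh b)\<^sup>2 + (cos a)\<^sup>2) / N"
    unfolding cot_def norm_divide power_divide N_def[symmetric]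
    unfolding cmod_power2 sn power2_minus power_mult_distrib sc by (simp add: algebra_simps)
  also have "\<dots> \<le> (cosh b)\<^sup>2 / N"
    using N0 sc by (intro divide_right_mono) (auto simp: abs_square_le_1)
  finally have "b * (norm (cot w))\<^sup>2 \<le> b * ((cosh b)\<^sup>2 / N)"
    using b by (intro mult_left_mono) auto
  also have "\<dots> = b * coth b * (- Im (cot w))"
    unfolding im coth_def using s by (simp add: power2_eq_square)
  also have "\<dots> \<le> Y * coth Y * (- Im (cot w))"
    using mult_coth_mono[of b Y] b assms N0 s unfolding im
    by (intro mult_right_mono) (auto simp: b_def intro!: divide_nonneg_pos)
  finally show ?thesis by (simp add: b_def)
qed

text \<open>The pointwise estimate that fixes the constant of the theorem.\<close>
lemma pi_cot_sq_le_lattice_sum: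
  fixes z :: complex
  assumes z: "z \<notin> \<int>" and b: "0 \<le> Im z" "Im z \<le> B" "0 < B"
  shows "(norm (of_real pi * cot (of_real pi * z)))\<^sup>2 \<le> pi * B * coth (pi * B) * lattice_sum z"
proof -
  have pos: "(norm (of_real pi * cot (of_real pi * w)))\<^sup>2 \<le> pi * B * coth (pi * B) * lattice_sum w"
    if w: "0 < Im w" "Im w \<le> B" for w :: complex
  proof -
    have w': "w \<notin> \<int>" using w by (auto elim!: Ints_cases)
    have "Im w * (norm (of_real pi * cot (of_real pi * w)))\<^sup>2
        = pi * (Im (of_real pi * w) * (norm (cot (of_real pi * w)))\<^sup>2)"
      by (simp add: norm_mult power2_eq_square)
    also have "\<dots> \<le> pi * ((pi * B) * coth (pi * B) * (- Im (cot (of_real pi * w))))"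
      using w by (intro mult_left_mono norm_cot_sq_le) auto
    also have "\<dots> = pi * B * coth (pi * B) * (Im w * lattice_sum w)"
      unfolding Im_mult_lattice_sum[OF w'] by simp
    finally have "Im w * (norm (of_real pi * cot (of_real pi * w)))\<^sup>2
        \<le> Im w * (pi * B * coth (pi * B) * lattice_sum w)" by (simp add: ac_simps)
    then show ?thesis using w by simp
  qed
  show ?thesis
  proof (cases "Im z = 0")
    case False
    then show ?thesis using pos[of z] b by simp
  next
    case True
    \<comment> \<open>On the real axis the identity for \<open>Im z * lattice_sum z\<close> is void. Moving \<open>z\<close> upwards only
      decreases the lattice sum, so the estimate survives the limit \<open>t \<rightarrow> 0\<close>.\<close>
    let ?w = "\<lambda>t. z + \<i> * of_real t"
    have K: "0 \<le> pi * B * coth (pi * B)"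
      using b(3) by (simp add: coth_def)
    have ev: "\<forall>\<^sub>F t in at_right 0. (norm (of_real pi * cot (of_real pi * ?w t)))\<^sup>2
        \<le> pi * B * coth (pi * B) * lattice_sum z"
      using eventually_at_right_less eventually_at_right_real[OF b(3)]
    proof eventually_elim
      case (elim t)
      have w': "?w t \<notin> \<int>" using elim True by (auto elim!: Ints_cases simp: complex_eq_iff)
      have "lattice_sum (?w t) \<le> lattice_sum z"
        unfolding lattice_sum_def
      proof (intro infsum_mono summable_lattice_sum w' z)
        fix k :: int
        have "0 < (norm (z - of_int k))\<^sup>2" using z by auto
        moreover have "(norm (z - of_int k))\<^sup>2 \<le> (norm (?w t - of_int k))\<^sup>2"
          using True by (simp add: cmod_power2)
        ultimately show "1 / (norm (?w t - of_int k))\<^sup>2 \<le> 1 / (norm (z - of_int k))\<^sup>2"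
          by (intro divide_left_mono mult_pos_pos) auto
      qed
      then have "pi * B * coth (pi * B) * lattice_sum (?w t) \<le> pi * B * coth (pi * B) * lattice_sum z"
        using K by (rule mult_left_mono)
      moreover have "(norm (of_real pi * cot (of_real pi * ?w t)))\<^sup>2 \<le> pi * B * coth (pi * B) * lattice_sum (?w t)"
        using elim True by (intro pos) auto
      ultimately show ?case by linarith
    qed
    have "isCont (\<lambda>t. (norm (of_real pi * cot (of_real pi * ?w t)))\<^sup>2) 0"
      unfolding cot_def using z by (intro continuous_intros) (auto simp: sin_eq_0)
    then have "((\<lambda>t. (norm (of_real pi * cot (of_real pi * ?w t)))\<^sup>2)
        \<longlongrightarrow> (norm (of_real pi * cot (of_real pi * z)))\<^sup>2) (at_right 0)"
      by (auto simp: isCont_def intro: tendsto_within_subset)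
    then show ?thesis using ev
      by (rule tendsto_upperbound) simp
  qed
qed

section \<open>Integrals of directional derivatives\<close>

lemma integral_translation:
  fixes f :: "'a::euclidean_space \<Rightarrow> real"
  assumes "integrable lborel f"
  shows "integrable lborel (\<lambda>x. f (a + x))" "(LINT x|lborel. f (a + x)) = (LINT x|lborel. f x)"
proof -
  have *: "lborel = distr lborel borel ((+) a)" by (rule lborel_distr_plus[symmetric])
  have f: "f \<in> borel_measurable borel" using assms by (simp add: measurable_lborel1)
  show "integrable lborel (\<lambda>x. f (a + x))"
    using assms by (subst (asm) *, subst (asm) integrable_distr_eq) (use f in auto)
  show "(LINT x|lborel. f (a + x)) = (LINT x|lborel. f x)"
    by (subst (2) *, subst integral_distr) (use f in auto)
qed

lemma integrable_continuous_compact_support: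
  fixes f :: "'a::euclidean_space \<Rightarrow> real"
  assumes "continuous_on UNIV f" "compact K" "\<And>x. x \<notin> K \<Longrightarrow> f x = 0"
  shows "integrable lborel f"
proof -
  have "integrable lborel (\<lambda>x. indicator K x *\<^sub>R f x)"
    by (intro borel_integrable_compact assms continuous_on_subset[OF assms(1)]) auto
  moreover have "(\<lambda>x. indicator K x *\<^sub>R f x) = f"
    using assms(3) by (intro ext) (metis indicator_simps scaleR_one scaleR_zero_left)
  ultimately show ?thesis by simp
qed

text \<open>The integral of the difference quotients of \<open>f\<close> vanishes by translation invariance of Lebesgue
  measure. They are bounded by the supremum of the derivative on a fixed compact set, so dominated
  convergence passes to the derivative.\<close>
lemma integral_directional_derivative_eq_0:
  fixes f :: "'a::euclidean_space \<Rightarrow> real"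
  assumes der: "\<And>x. (f has_derivative f' x) (at x)"
    and cont: "continuous_on UNIV (\<lambda>x. f' x e)"
    and K: "compact K" "\<And>x. x \<notin> K \<Longrightarrow> f x = 0"
  shows "integrable lborel (\<lambda>x. f' x e)" "(LINT x|lborel. f' x e) = 0"
proof -
  let ?g = "\<lambda>x. f' x e"
  have g0: "?g x = 0" if "x \<notin> K" for x
  proof -
    have "open (- K)" using K by (simp add: compact_imp_closed open_Compl)
    then have "(f has_derivative (\<lambda>_. 0)) (at x)"
      by (rule has_derivative_transform_within_open[OF has_derivative_const]) (use that K in auto)
    from has_derivative_unique[OF der this] show ?thesis by simp
  qed
  have cf: "continuous_on UNIV f"
    by (intro continuous_at_imp_continuous_on ballI has_derivative_continuous[OF der])
  have intf: "integrable lborel f"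
    by (rule integrable_continuous_compact_support[OF cf K])
  show intg: "integrable lborel ?g"
    by (rule integrable_continuous_compact_support[OF cont K(1) g0])
  obtain C where C: "0 < C" "\<And>x. \<bar>?g x\<bar> \<le> C"
  proof -
    have "compact (?g ` K)"
      by (intro compact_continuous_image K(1) continuous_on_subset[OF cont]) simp
    then obtain C where C: "0 < C" "\<And>x. x \<in> K \<Longrightarrow> \<bar>?g x\<bar> \<le> C"
      by (auto dest!: compact_imp_bounded simp: bounded_pos)
    have "\<bar>?g x\<bar> \<le> C" for x
      using C g0[of x] by (cases "x \<in> K") auto
    with C(1) show ?thesis by (rule that)
  qed
  have line: "((\<lambda>t. f (t *\<^sub>R e + x)) has_real_derivative ?g (t *\<^sub>R e + x)) (at t)" for x t
  proof -
    have "((\<lambda>t. f (t *\<^sub>R e + x)) has_derivative (\<lambda>s. f' (t *\<^sub>R e + x) (s *\<^sub>R e))) (at t)"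
      by (rule has_derivative_compose[OF _ der]) (auto intro!: derivative_eq_intros)
    moreover have "f' (t *\<^sub>R e + x) (s *\<^sub>R e) = ?g (t *\<^sub>R e + x) * s" for s
      using linear_cmul[OF has_derivative_linear[OF der]] by simp
    ultimately show ?thesis
      by (simp add: has_field_derivative_def)
  qed
  define q where "q n x = real (Suc n) * (f (inverse (real (Suc n)) *\<^sub>R e + x) - f x)" for n x
  have int_q: "(LINT x|lborel. q n x) = 0" for n
    unfolding q_def using integral_translation[OF intf] intf by simp
  have lim_q: "(\<lambda>n. q n x) \<longlonglongrightarrow> ?g x" for x
  proof -
    have "((\<lambda>t. f (t *\<^sub>R e + x)) has_real_derivative ?g x) (at 0)"
      using line[of x 0] by simp
    then have "((\<lambda>t. (f (t *\<^sub>R e + x) - f x) / t) \<longlongrightarrow> ?g x) (at 0)"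
      by (simp add: has_field_derivative_iff)
    moreover have "filterlim (\<lambda>n. inverse (real (Suc n))) (at 0) sequentially"
      unfolding filterlim_at using LIMSEQ_inverse_real_of_nat by auto
    ultimately have "(\<lambda>n. (f (inverse (real (Suc n)) *\<^sub>R e + x) - f x) / inverse (real (Suc n))) \<longlonglongrightarrow> ?g x"
      by (rule filterlim_compose)
    then show ?thesis unfolding q_def by (simp add: divide_inverse mult.commute)
  qed
  \<comment> \<open>\<open>K'\<close> contains the supports of all \<open>q n\<close>, as their step lengths are at most \<open>norm e\<close>.\<close>
  define K' where "K' = {x + y |x y. x \<in> K \<and> y \<in> cball 0 (norm e)}"
  have K': "compact K'"
    unfolding K'_def by (intro compact_sums K compact_cball)
  have bound_q: "\<bar>q n x\<bar> \<le> C * indicator K' x" for n x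
  proof (cases "x \<in> K'")
    case True
    let ?t = "inverse (real (Suc n))"
    have "\<bar>f (?t *\<^sub>R e + x) - f (0 *\<^sub>R e + x)\<bar> \<le> C * \<bar>?t - 0\<bar>"
      by (rule field_differentiable_bound[OF convex_UNIV line, unfolded real_norm_def]) (use C in auto)
    then have "\<bar>q n x\<bar> \<le> real (Suc n) * (C * ?t)"
      unfolding q_def abs_mult by (intro mult_mono) auto
    also have "\<dots> = C" by (simp add: divide_simps)
    finally show ?thesis using True by simp
  next
    case False
    have "x \<notin> K" using False unfolding K'_def by force
    moreover have "inverse (real (Suc n)) *\<^sub>R e + x \<notin> K"
    proof
      assume "inverse (real (Suc n)) *\<^sub>R e + x \<in> K"
      moreover have "norm (- (inverse (real (Suc n)) *\<^sub>R e)) \<le> norm e"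
        by (simp add: field_simps)
      ultimately have "x \<in> K'" unfolding K'_def
        by (intro CollectI exI[of _ "inverse (real (Suc n)) *\<^sub>R e + x"] exI[of _ "- (inverse (real (Suc n)) *\<^sub>R e)"]) auto
      then show False using False by simp
    qed
    ultimately show ?thesis using K(2) False by (simp add: q_def)
  qed
  have "(\<lambda>n. LINT x|lborel. q n x) \<longlonglongrightarrow> (LINT x|lborel. ?g x)"
  proof (rule integral_dominated_convergence)
    show "?g \<in> borel_measurable lborel" using intg by auto
    show "q n \<in> borel_measurable lborel" for n
    proof -
      have "continuous_on UNIV (q n)"
        unfolding q_def by (intro continuous_intros continuous_on_compose2[OF cf]) auto
      then show ?thesis by (simp add: borel_measurable_continuous_onI)
    qed
    show "integrable lborel (\<lambda>x. C * indicator K' x)"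
      using K' by (intro integrable_mult_right integrable_real_indicator emeasure_bounded_finite compact_imp_bounded)
        (auto simp: compact_imp_closed)
  qed (use lim_q bound_q in auto)
  then show "(LINT x|lborel. ?g x) = 0"
    using int_q by (simp add: LIMSEQ_const_iff)
qed

section \<open>Divergence of the pole field\<close>

lemma grad_inner: "grad u x \<bullet> v = (\<Sum>i\<in>UNIV. frechet_derivative u (at x) (axis i 1) * v $ i)"
  by (simp add: grad_def inner_vec_def)

lemma smooth_derivative:
  assumes "smooth u"
  shows "(u has_derivative frechet_derivative u (at x)) (at x)"
    and "continuous_on UNIV (\<lambda>x. frechet_derivative u (at x) v)"
proof -
  have "times_differentiable (Suc 0) u" using assms unfolding smooth_def by blast
  then show "(u has_derivative frechet_derivative u (at x)) (at x)"
    "continuous_on UNIV (\<lambda>x. frechet_derivative u (at x) v)"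
    by (auto simp: frechet_derivative_works)
qed

lemma continuous_on_grad:
  assumes "smooth u"
  shows "continuous_on UNIV (grad u)"
  unfolding grad_def using smooth_derivative(2)[OF assms] by (intro continuous_on_vec_lambda)

lemma grad_eq_0:
  assumes "closed K" "\<And>x. x \<notin> K \<Longrightarrow> u x = 0" "x \<notin> K"
  shows "grad u x = 0"
proof -
  have "open (- K)" using assms by (simp add: open_Compl)
  then have "(u has_derivative (\<lambda>_. 0)) (at x)"
    by (rule has_derivative_transform_within_open[OF has_derivative_const]) (use assms in auto)
  then have *: "frechet_derivative u (at x) = (\<lambda>_. 0)"
    by (rule frechet_derivative_at[symmetric])
  show ?thesis unfolding grad_def * by (simp add: vec_eq_iff)
qed

text \<open>The divergence theorem for the field \<open>(u x)\<^sup>2 * (x - a) / (norm (x - a))\<^sup>2\<close>, whose singularity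
  lies off the support of \<open>u\<close>. The field \<open>(x - a) / (norm (x - a))\<^sup>2\<close> has divergence
  \<open>(d - 2) / (norm (x - a))\<^sup>2\<close> where \<open>d = CARD('n)\<close>.\<close>
lemma integral_divergence_pole_field:
  fixes u :: "real ^ 'n \<Rightarrow> real"
  assumes u: "smooth u" and K: "compact K" "\<And>x. x \<notin> K \<Longrightarrow> u x = 0" and a: "a \<notin> K"
  defines "D \<equiv> \<lambda>x. 2 * u x * (grad u x \<bullet> (x - a)) / (norm (x - a))\<^sup>2
      + (real CARD('n) - 2) * (u x)\<^sup>2 / (norm (x - a))\<^sup>2"
  shows "integrable lborel D" "(LINT x|lborel. D x) = 0"
proof -
  let ?u' = "\<lambda>x. frechet_derivative u (at x)"
  let ?g = "\<lambda>i x. (u x)\<^sup>2 * ((x - a) $ i / ((x - a) \<bullet> (x - a)))"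
  let ?g' = "\<lambda>i x v. 2 * u x * ?u' x v * ((x - a) $ i / ((x - a) \<bullet> (x - a)))
      + (u x)\<^sup>2 * (v $ i / ((x - a) \<bullet> (x - a)) - 2 * (x - a) $ i * ((x - a) \<bullet> v) / ((x - a) \<bullet> (x - a))\<^sup>2)"
  have oK: "open (- K)" using K by (simp add: compact_imp_closed open_Compl)
  note u' = smooth_derivative[OF u]
  have cu: "continuous_on UNIV u"
    by (intro continuous_at_imp_continuous_on ballI has_derivative_continuous[OF u'(1)])
  have der: "(?g i has_derivative ?g' i x) (at x)" for i x
  proof (cases "x = a")
    case True
    \<comment> \<open>Near the pole the product vanishes identically; the formula for its derivative gives \<open>0\<close>
      there because \<open>u\<close> does.\<close>
    have "(?g i has_derivative (\<lambda>_. 0)) (at x)"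
      by (rule has_derivative_transform_within_open[OF has_derivative_const oK])
        (use True a K(2) in auto)
    then show ?thesis using True a K(2) by simp
  next
    case False
    then have nz: "(x - a) \<bullet> (x - a) \<noteq> 0" by simp
    show ?thesis
      by (rule derivative_eq_intros refl u'(1) bounded_linear.has_derivative[OF bounded_linear_vec_nth] nz)+
        (use nz in \<open>simp add: fun_eq_iff field_simps power2_eq_square inner_commute\<close>)
  qed
  have cont: "continuous_on UNIV (\<lambda>x. ?g' i x (axis i 1))" for i
  proof -
    have "continuous_on (- {a}) (\<lambda>x. ?g' i x (axis i 1))"
      by (intro continuous_intros continuous_on_subset[OF u'(2)] continuous_on_subset[OF cu]) auto
    moreover have "continuous_on (- K) (\<lambda>x. ?g' i x (axis i 1))"
      by (rule continuous_on_eq[of _ "\<lambda>_. 0"]) (use K(2) in auto)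
    ultimately have "continuous_on (- {a} \<union> - K) (\<lambda>x. ?g' i x (axis i 1))"
      by (intro continuous_on_open_Un oK) auto
    moreover have "- {a} \<union> - K = UNIV" using a by auto
    ultimately show ?thesis by simp
  qed
  have g0: "?g i x = 0" if "x \<notin> K" for i x using K(2)[OF that] by simp
  have D: "D x = (\<Sum>i\<in>UNIV. ?g' i x (axis i 1))" for x
  proof -
    define y where "y = x - a"
    define q where "q = y \<bullet> y"
    have "(\<Sum>i\<in>UNIV. ?g' i x (axis i 1)) = (\<Sum>i\<in>UNIV. 2 * u x / q * (?u' x (axis i 1) * y $ i)
        + (u x)\<^sup>2 / q - 2 * (u x)\<^sup>2 / q\<^sup>2 * (y $ i * y $ i))"
      by (intro sum.cong refl) (simp add: q_def inner_axis right_diff_distrib mult_ac flip: y_def)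
    also have "\<dots> = 2 * u x / q * (\<Sum>i\<in>UNIV. ?u' x (axis i 1) * y $ i)
        + real CARD('n) * ((u x)\<^sup>2 / q) - 2 * (u x)\<^sup>2 / q\<^sup>2 * (\<Sum>i\<in>UNIV. y $ i * y $ i)"
      by (simp only: sum.distrib sum_subtractf sum_distrib_left[symmetric] sum_constant)
    also have "\<dots> = 2 * u x / q * (grad u x \<bullet> y) + real CARD('n) * ((u x)\<^sup>2 / q) - 2 * (u x)\<^sup>2 / q\<^sup>2 * q"
      by (simp only: grad_inner q_def inner_vec_def[of y y] inner_real_def)
    also have "\<dots> = D x"
      unfolding D_def power2_norm_eq_inner y_def[symmetric] q_def[symmetric]
      by (cases "q = 0") (simp_all add: power2_eq_square field_simps)
    finally show ?thesis by simp
  qed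
  have I: "integrable lborel (\<lambda>x. ?g' i x (axis i 1))" "(LINT x|lborel. ?g' i x (axis i 1)) = 0" for i
    by (rule integral_directional_derivative_eq_0[where f = "?g i" and f' = "?g' i" and e = "axis i 1",
          OF der cont K(1) g0], assumption)+
  show "integrable lborel D" unfolding D by (intro Bochner_Integration.integrable_sum I(1))
  show "(LINT x|lborel. D x) = 0" unfolding D
    by (subst Bochner_Integration.integral_sum) (use I in auto)
qed

text \<open>The gradient of the function \<open>\<Sum>k\<in>A. ln (norm (x - a\<^sub>k))\<close> with \<open>a\<^sub>k = pole h k\<close>, for a finite set \<open>A\<close> of indices.\<close>
definition pole_field :: "real \<Rightarrow> int set \<Rightarrow> real ^ 'n \<Rightarrow> real ^ 'n" where
  "pole_field h A x = (\<Sum>k\<in>A. (1 / (norm (x - pole h k))\<^sup>2) *\<^sub>R (x - pole h k))"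

text \<open>The contribution of the poles with index in the finite set \<open>A\<close> to the potential.\<close>
definition partial_potential :: "real \<Rightarrow> int set \<Rightarrow> real ^ 'n \<Rightarrow> real" where
  "partial_potential h A x = (\<Sum>k\<in>A. 1 / (norm (x - pole h k))\<^sup>2)"

lemma integral_divergence_multipole_field:
  fixes u :: "real ^ 'n \<Rightarrow> real"
  assumes u: "smooth u" and K: "compact K" "\<And>x. x \<notin> K \<Longrightarrow> u x = 0" and a: "K \<inter> range (pole h) = {}"
  fixes A :: "int set"
  defines "D \<equiv> \<lambda>x. 2 * u x * (grad u x \<bullet> pole_field h A x)
      + (real CARD('n) - 2) * (u x)\<^sup>2 * partial_potential h A x"
  shows "integrable lborel D" "(LINT x|lborel. D x) = 0"
proof -
  have D: "D x = (\<Sum>k\<in>A. 2 * u x * (grad u x \<bullet> (x - pole h k)) / (norm (x - pole h k))\<^sup>2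
      + (real CARD('n) - 2) * (u x)\<^sup>2 / (norm (x - pole h k))\<^sup>2)" for x
    unfolding D_def pole_field_def partial_potential_def
    by (simp add: inner_sum_right sum.distrib sum_distrib_left)
  have "pole h k \<notin> K" for k using a by auto
  note I = integral_divergence_pole_field[OF u K this]
  show "integrable lborel D" unfolding D by (intro Bochner_Integration.integrable_sum I(1))
  show "(LINT x|lborel. D x) = 0" unfolding D
    by (subst Bochner_Integration.integral_sum) (use I in auto)
qed

section \<open>The complex coordinate along the axis\<close>

text \<open>For \<open>d = CARD('n)\<close>, the coordinate along the axis as real part and the distance to the axis as
  imaginary part, both scaled by \<open>sqrt d\<close>. When \<open>d * h = 1\<close> this sends the \<open>k\<close>-th pole to the
  integer \<open>k\<close>.\<close>
definition axial_coord :: "real ^ 'n \<Rightarrow> complex" where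
  "axial_coord x = Complex (\<Sum>i\<in>UNIV. x $ i) (sqrt (real CARD('n) * (norm x)\<^sup>2 - (\<Sum>i\<in>UNIV. x $ i)\<^sup>2))"

lemma square_sum_le_card_mult_norm: "(\<Sum>i\<in>UNIV. x $ i)\<^sup>2 \<le> real CARD('n) * (norm (x :: real ^ 'n))\<^sup>2"
proof -
  have "x \<bullet> (\<chi> i. 1) = (\<Sum>i\<in>UNIV. x $ i)" "(\<chi> i. 1) \<bullet> ((\<chi> i. 1) :: real ^ 'n) = real CARD('n)"
    by (simp_all add: inner_vec_def)
  then show ?thesis using Cauchy_Schwarz_ineq[of x "\<chi> i. 1"]
    by (simp add: power2_norm_eq_inner mult.commute)
qed

text \<open>On the half-plane through the axis and \<open>x\<close>, the coordinate is \<open>sqrt d\<close> times an isometry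
  that maps the axis to the real line. The scalars \<open>c\<close> and \<open>D\<close> allow for arbitrary combinations
  of \<open>x\<close> and the poles.\<close>
lemma norm_axial_coord:
  fixes x :: "real ^ 'n"
  assumes h: "real CARD('n) * h = 1"
  shows "(norm (of_real c * axial_coord x - of_real D))\<^sup>2
    = real CARD('n) * (norm (c *\<^sub>R x - D *\<^sub>R pole h 1))\<^sup>2"
proof -
  let ?d = "real CARD('n)" and ?s = "\<Sum>i\<in>UNIV. x $ i"
  have "(norm (of_real c * axial_coord x - of_real D))\<^sup>2 = (c * ?s - D)\<^sup>2 + c\<^sup>2 * (?d * (norm x)\<^sup>2 - ?s\<^sup>2)"
    using square_sum_le_card_mult_norm[of x] by (simp add: axial_coord_def cmod_power2 power_mult_distrib)
  also have "\<dots> = ?d * c\<^sup>2 * (norm x)\<^sup>2 - 2 * c * D * ?s + D\<^sup>2"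
    by (simp add: power2_eq_square algebra_simps)
  also have "\<dots> = ?d * c\<^sup>2 * (norm x)\<^sup>2 - 2 * c * D * ?s * (?d * h) + D\<^sup>2 * (?d * h)\<^sup>2"
    by (simp add: h)
  also have "\<dots> = ?d * (c\<^sup>2 * (x \<bullet> x) - 2 * c * D * (h * ?s) + D\<^sup>2 * (?d * h\<^sup>2))"
    unfolding power2_norm_eq_inner[of x] by (simp add: power2_eq_square algebra_simps)
  also have "h * ?s = x \<bullet> pole h 1"
    by (simp add: inner_vec_def pole_def sum_distrib_left mult.commute)
  also have "?d * h\<^sup>2 = pole h 1 \<bullet> (pole h 1 :: real ^ 'n)"
    by (simp add: inner_vec_def pole_def power2_eq_square)
  also have "c\<^sup>2 * (x \<bullet> x) - 2 * c * D * (x \<bullet> pole h 1) + D\<^sup>2 * (pole h 1 \<bullet> (pole h 1 :: real ^ 'n))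
      = (norm (c *\<^sub>R x - D *\<^sub>R pole h 1))\<^sup>2"
    unfolding power2_norm_eq_inner
    by (simp add: inner_diff inner_commute power2_eq_square algebra_simps)
  finally show ?thesis .
qed

lemma pole_eq: "pole h k = of_int k *\<^sub>R pole h 1"
  by (simp add: pole_def vec_eq_iff)

lemma norm_axial_coord_diff_of_int:
  fixes x :: "real ^ 'n"
  assumes "real CARD('n) * h = 1"
  shows "(norm (axial_coord x - of_int k))\<^sup>2 = real CARD('n) * (norm (x - pole h k))\<^sup>2"
  using norm_axial_coord[OF assms, of 1 x "of_int k"] by (simp flip: pole_eq)

lemma axial_coord_in_Ints_iff:
  fixes x :: "real ^ 'n"
  assumes "real CARD('n) * h = 1"
  shows "axial_coord x \<in> \<int> \<longleftrightarrow> x \<in> range (pole h)"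
proof -
  have "axial_coord x = of_int k \<longleftrightarrow> x = pole h k" for k
    using norm_axial_coord_diff_of_int[OF assms, of x k] by auto
  then show ?thesis by (auto elim!: Ints_cases) (metis Ints_of_int)
qed

lemma partial_potential_eq:
  fixes x :: "real ^ 'n"
  assumes "real CARD('n) * h = 1"
  shows "partial_potential h A x = real CARD('n) * (\<Sum>k\<in>A. 1 / (norm (axial_coord x - of_int k))\<^sup>2)"
  unfolding partial_potential_def norm_axial_coord_diff_of_int[OF assms]
  by (simp add: sum_distrib_left)

lemma potential_eq:
  fixes x :: "real ^ 'n"
  assumes "real CARD('n) * h = 1"
  shows "potential h x = real CARD('n) * lattice_sum (axial_coord x)"
  unfolding potential_def lattice_sum_def norm_axial_coord_diff_of_int[OF assms]
  by (simp flip: infsum_cmult_right')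

text \<open>The field lies in the plane of the axis and \<open>x\<close>, where it corresponds to the complex conjugate
  of the partial sum of the cotangent.\<close>
lemma norm_pole_field:
  fixes x :: "real ^ 'n"
  assumes h: "real CARD('n) * h = 1"
  shows "(norm (pole_field h A x))\<^sup>2 = real CARD('n) * (norm (\<Sum>k\<in>A. 1 / (axial_coord x - of_int k)))\<^sup>2"
proof -
  let ?d = "real CARD('n)" and ?z = "axial_coord x"
  define c where "c k = 1 / (norm (x - pole h k))\<^sup>2" for k
  have c: "c k = ?d / (norm (?z - of_int k))\<^sup>2" for k
    by (simp add: c_def norm_axial_coord_diff_of_int[OF h])
  have "pole_field h A x = (\<Sum>k\<in>A. c k *\<^sub>R x - (c k * of_int k) *\<^sub>R pole h 1)"
    unfolding pole_field_def c_def[symmetric]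
    by (intro sum.cong refl) (subst pole_eq, simp add: scaleR_diff_right)
  also have "\<dots> = (\<Sum>k\<in>A. c k) *\<^sub>R x - (\<Sum>k\<in>A. c k * of_int k) *\<^sub>R pole h 1"
    by (simp add: sum_subtractf scaleR_sum_left)
  finally have "?d * (norm (pole_field h A x))\<^sup>2
      = (norm (of_real (\<Sum>k\<in>A. c k) * ?z - of_real (\<Sum>k\<in>A. c k * of_int k)))\<^sup>2"
    using norm_axial_coord[OF h, of "\<Sum>k\<in>A. c k" x "\<Sum>k\<in>A. c k * of_int k"] by simp
  also have "of_real (\<Sum>k\<in>A. c k) * ?z - of_real (\<Sum>k\<in>A. c k * of_int k) = (\<Sum>k\<in>A. of_real (c k) * (?z - of_int k))"
    by (simp add: sum_distrib_right sum_subtractf right_diff_distrib)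
  also have "\<dots> = (\<Sum>k\<in>A. of_real ?d * cnj (1 / (?z - of_int k)))"
  proof (intro sum.cong refl)
    fix k
    have "of_real (?d / (norm w)\<^sup>2) * w = of_real ?d * cnj (1 / w)" for w :: complex
      by (cases "w = 0") (simp_all only: of_real_divide complex_norm_square, simp_all)
    then show "of_real (c k) * (?z - of_int k) = of_real ?d * cnj (1 / (?z - of_int k))"
      unfolding c .
  qed
  also have "\<dots> = of_real ?d * cnj (\<Sum>k\<in>A. 1 / (?z - of_int k))"
    by (simp only: sum_distrib_left[symmetric] cnj_sum)
  also have "(norm (of_real ?d * cnj (\<Sum>k\<in>A. 1 / (?z - of_int k))))\<^sup>2 = ?d * (?d * (norm (\<Sum>k\<in>A. 1 / (?z - of_int k)))\<^sup>2)"
    by (simp only: norm_mult complex_mod_cnj power_mult_distrib) (simp add: power2_eq_square)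
  finally show ?thesis by simp
qed

lemma Im_axial_coord_nonneg: "0 \<le> Im (axial_coord x)"
  using square_sum_le_card_mult_norm[of x] by (simp add: axial_coord_def)

lemma Im_axial_coord_le_infdist:
  fixes x :: "real ^ 'n"
  shows "Im (axial_coord x) \<le> sqrt (real CARD('n)) * infdist x diagonal"
proof -
  let ?d = "real CARD('n)" and ?s = "\<Sum>i\<in>UNIV. x $ i"
  have ne: "(diagonal :: (real ^ 'n) set) \<noteq> {}" by (auto simp: diagonal_def)
  have "Im (axial_coord x) / sqrt ?d \<le> dist x y" if yd: "y \<in> diagonal" for y
  proof -
    obtain t where y: "y = (\<chi> i. t)" using yd by (auto simp: diagonal_def)
    have "x \<bullet> y = t * ?s" "y \<bullet> y = ?d * t\<^sup>2"
      by (simp_all add: y inner_vec_def sum_distrib_left power2_eq_square mult.commute)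
    then have "(norm (x - y))\<^sup>2 = (norm x)\<^sup>2 - 2 * t * ?s + ?d * t\<^sup>2"
      unfolding power2_norm_eq_inner by (simp add: inner_diff inner_commute)
    then have "?d * (norm (x - y))\<^sup>2 = ?d * (norm x)\<^sup>2 - ?s\<^sup>2 + (?d * t - ?s)\<^sup>2"
      by (simp only:) (simp add: power2_eq_square algebra_simps)
    then have "sqrt (?d * (norm x)\<^sup>2 - ?s\<^sup>2) \<le> sqrt (?d * (norm (x - y))\<^sup>2)"
      by simp
    then show ?thesis by (simp add: axial_coord_def real_sqrt_mult dist_norm field_simps)
  qed
  then have "Im (axial_coord x) / sqrt ?d \<le> infdist x diagonal"
    unfolding infdist_notempty[OF ne] by (intro cINF_greatest ne)
  then show ?thesis by (simp add: field_simps)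
qed

lemma closed_range_pole:
  assumes "h \<noteq> 0"
  shows "closed (range (pole h :: int \<Rightarrow> real ^ 'n))"
proof -
  have nz: "(pole h 1 :: real ^ 'n) \<noteq> 0" using assms by (simp add: pole_def vec_eq_iff)
  have "range (pole h :: int \<Rightarrow> real ^ 'n) = (\<lambda>t. t *\<^sub>R pole h 1) ` \<int>"
    by (auto simp: Ints_def image_image simp flip: pole_eq)
  moreover have "closed ((\<lambda>t. t *\<^sub>R (pole h 1 :: real ^ 'n)) ` \<int>)"
    using nz by (intro closed_injective_linear_image closed_Ints) (auto simp: inj_on_def linear_iff algebra_simps)
  ultimately show ?thesis by simp
qed

lemma lattice_sum_bounded_on_compact:
  fixes K :: "(real ^ 'n) set"
  assumes h: "real CARD('n) * h = 1" and K: "compact K" "K \<inter> range (pole h) = {}"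
  obtains C where "0 \<le> C" "\<And>x. x \<in> K \<Longrightarrow> lattice_sum (axial_coord x) \<le> C" "\<And>x. x \<in> K \<Longrightarrow> norm (axial_coord x) \<le> C"
proof -
  let ?d = "real CARD('n)"
  have h0: "h \<noteq> 0" using h by auto
  obtain \<delta> where \<delta>: "0 < \<delta>" "\<And>x k. x \<in> K \<Longrightarrow> \<delta> \<le> norm (x - pole h k)"
    using separate_compact_closed[OF K(1) closed_range_pole[OF h0] K(2)] by (auto simp: dist_norm)
  obtain B where B: "\<And>x. x \<in> K \<Longrightarrow> norm x \<le> B"
    using compact_imp_bounded[OF K(1)] by (auto simp: bounded_iff)
  have sc: "norm (axial_coord x - of_int k) = sqrt ?d * norm (x - pole h k)" for x :: "real ^ 'n" and k
    using norm_axial_coord_diff_of_int[OF h, of x k]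
    by (metis real_sqrt_mult norm_ge_zero real_sqrt_abs abs_of_nonneg)
  have p0: "pole h 0 = 0" by (simp add: pole_def vec_eq_iff)
  have nz: "norm (axial_coord x) = sqrt ?d * norm x" for x :: "real ^ 'n"
    using sc[of x 0] by (simp add: p0)
  have \<delta>': "0 < sqrt ?d * \<delta>" using \<delta>(1) by simp
  obtain C where C: "\<And>z. norm z \<le> sqrt ?d * B \<Longrightarrow> (\<And>k::int. sqrt ?d * \<delta> \<le> norm (z - of_int k)) \<Longrightarrow> lattice_sum z \<le> C"
    using lattice_sum_bound[OF \<delta>', where B = "sqrt ?d * B"] by blast
  have 1: "norm (axial_coord x) \<le> sqrt ?d * B" if "x \<in> K" for x
    unfolding nz by (intro mult_left_mono B that) simp
  show ?thesis
  proof (rule that[of "max 0 (max C (sqrt ?d * B))"])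
    fix x assume x: "x \<in> K"
    have "lattice_sum (axial_coord x) \<le> C"
      using \<delta>(2)[OF x] by (intro C 1 x) (simp add: sc)
    then show "lattice_sum (axial_coord x) \<le> max 0 (max C (sqrt ?d * B))" by simp
  qed (use 1 in force)+
qed

section \<open>The multipolar Hardy inequality\<close>

theorem theorem3p1:
  fixes h R :: real and u :: "real ^ 'n \<Rightarrow> real"
  assumes "h > 0" and "real CARD('n) * h = 1"
    and "R > 0"
    and "u \<in> test_functions (interior (cylinder R) - range (pole h))"
  shows "(LINT x:cylinder R|lborel. (norm (grad u x))\<^sup>2)
    \<ge> (real CARD('n) - 2)\<^sup>2
        / (4 * pi * R * sqrt (real CARD('n)) * coth (pi * R * sqrt (real CARD('n))))
      * (LINT x:cylinder R|lborel. potential h x * (u x)\<^sup>2)"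
proof -
  let ?d = "real CARD('n)" and ?z = "axial_coord :: real ^ 'n \<Rightarrow> complex"
  let ?A = "\<lambda>m. {1 - int m..int m}"
  let ?cot = "\<lambda>x. of_real pi * cot (of_real pi * ?z x)"
  note h = assms(2)
  define K where "K = closure {x. u x \<noteq> 0}"
  have u: "smooth u" and K: "compact K" and Kcyl: "K \<subseteq> interior (cylinder R)"
    and Kpole: "K \<inter> range (pole h) = {}"
    using assms(4) by (auto simp: test_functions_def K_def)
  have u0: "u x = 0" if "x \<notin> K" for x
    using that closure_subset[of "{x. u x \<noteq> 0}"] by (auto simp: K_def)
  have cylI: "x \<in> cylinder R" if "x \<in> K" for x
    using that Kcyl interior_subset by blast
  have g0: "grad u x = 0" if "x \<notin> K" for x
    using grad_eq_0[of K u x] u0 that K by (auto simp: compact_imp_closed)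
  have znI: "?z x \<notin> \<int>" if "x \<in> K" for x
    using axial_coord_in_Ints_iff[OF h, of x] that Kpole by auto

  define \<kappa> where "\<kappa> = pi * (R * sqrt ?d) * coth (pi * (R * sqrt ?d))"
  have \<kappa>: "0 < \<kappa>"
    using assms(3) by (simp add: \<kappa>_def coth_def)
  \<comment> \<open>This value of \<open>\<alpha>\<close> maximizes \<open>\<alpha> * (d - 2) - \<alpha>\<^sup>2 * \<kappa>\<close>, with maximum \<open>(d - 2)\<^sup>2 / (4 * \<kappa>)\<close>.\<close>
  define \<alpha> where "\<alpha> = (?d - 2) / (2 * \<kappa>)"
  define L where "L m x = (u x)\<^sup>2 * (\<alpha> * (?d - 2) * partial_potential h (?A m) x
      - \<alpha>\<^sup>2 * (norm (pole_field h (?A m) x))\<^sup>2)" for m x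
  define Llim where "Llim x = (u x)\<^sup>2 * (\<alpha> * (?d - 2) * potential h x
      - \<alpha>\<^sup>2 * (?d * (norm (?cot x))\<^sup>2))" for x

  have cu: "continuous_on UNIV u"
    by (intro continuous_at_imp_continuous_on ballI has_derivative_continuous[OF smooth_derivative(1)[OF u]])
  have u_meas [measurable]: "u \<in> borel_measurable borel"
    using cu by (rule borel_measurable_continuous_onI)
  have int_u2: "integrable lborel (\<lambda>x. C * (u x)\<^sup>2)" for C
    by (rule integrable_continuous_compact_support[OF _ K]) (auto intro!: continuous_intros cu simp: u0)
  have int_grad: "integrable lborel (\<lambda>x. (norm (grad u x))\<^sup>2)"
    by (rule integrable_continuous_compact_support[OF _ K])
      (auto intro!: continuous_intros continuous_on_grad u simp: g0)
  have V_meas [measurable]: "(\<lambda>x :: real ^ 'n. partial_potential h A x) \<in> borel_measurable borel" for A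
    unfolding partial_potential_def by measurable
  have F_meas [measurable]: "(\<lambda>x :: real ^ 'n. pole_field h A x) \<in> borel_measurable borel" for A
    unfolding pole_field_def by measurable

  have V_lim: "(\<lambda>m. partial_potential h (?A m) x) \<longlonglongrightarrow> potential h x" if "x \<in> K" for x
    unfolding partial_potential_eq[OF h] potential_eq[OF h]
    by (intro tendsto_intros lattice_sum_limit znI that)
  have F_lim: "(\<lambda>m. (norm (pole_field h (?A m) x))\<^sup>2) \<longlonglongrightarrow> ?d * (norm (?cot x))\<^sup>2" if "x \<in> K" for x
    unfolding norm_pole_field[OF h]
    by (intro tendsto_intros cot_partial_fractions znI that)
  have Vu_lim: "(\<lambda>m. partial_potential h (?A m) x * (u x)\<^sup>2) \<longlonglongrightarrow> potential h x * (u x)\<^sup>2" for x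
  proof (cases "x \<in> K")
    case True
    then show ?thesis by (intro tendsto_intros V_lim)
  qed (simp add: u0)
  have L_lim: "(\<lambda>m. L m x) \<longlonglongrightarrow> Llim x" for x
  proof (cases "x \<in> K")
    case True
    then show ?thesis unfolding L_def Llim_def by (intro tendsto_intros V_lim F_lim)
  qed (simp add: u0 L_def Llim_def)

  \<comment> \<open>A multiple of \<open>u\<^sup>2\<close> dominates, since the lattice sum is bounded on the support of \<open>u\<close>.\<close>
  obtain C where C: "0 \<le> C" "\<And>x. x \<in> K \<Longrightarrow> lattice_sum (?z x) \<le> C" "\<And>x. x \<in> K \<Longrightarrow> norm (?z x) \<le> C"
    using lattice_sum_bounded_on_compact[OF h K Kpole] by metis
  define M\<^sub>V where "M\<^sub>V = ?d * C"
  define M\<^sub>F where "M\<^sub>F = ?d * ((C + 1) * C)\<^sup>2"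
  have V_nonneg: "0 \<le> partial_potential h A x" for A and x :: "real ^ 'n"
    unfolding partial_potential_def by (intro sum_nonneg) auto
  have V_bound: "partial_potential h (?A m) x \<le> M\<^sub>V" if "x \<in> K" for m x
    unfolding partial_potential_eq[OF h] M\<^sub>V_def
    by (intro mult_left_mono order_trans[OF sum_le_lattice_sum C(2)] znI that) auto
  have F_bound: "(norm (pole_field h (?A m) x))\<^sup>2 \<le> M\<^sub>F" if "x \<in> K" for m x
    unfolding norm_pole_field[OF h] M\<^sub>F_def
  proof (intro mult_left_mono power_mono)
    have "norm (\<Sum>k\<in>?A m. 1 / (?z x - of_int k)) \<le> (norm (?z x) + 1) * lattice_sum (?z x)"
      by (intro norm_cot_partial_sum_le znI that)
    also have "\<dots> \<le> (norm (?z x) + 1) * C"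
      by (intro mult_left_mono C that) auto
    also have "\<dots> \<le> (C + 1) * C"
      using C(1) C(3)[OF that] by (intro mult_right_mono) auto
    finally show "norm (\<Sum>k\<in>?A m. 1 / (?z x - of_int k)) \<le> (C + 1) * C" .
  qed auto
  have Vu_bound: "norm (partial_potential h (?A m) x * (u x)\<^sup>2) \<le> M\<^sub>V * (u x)\<^sup>2" for m x
  proof (cases "x \<in> K")
    case True
    then show ?thesis using V_nonneg V_bound by (auto simp: abs_mult intro!: mult_right_mono)
  qed (simp add: u0)
  have L_bound: "norm (L m x) \<le> (\<bar>\<alpha> * (?d - 2)\<bar> * M\<^sub>V + \<alpha>\<^sup>2 * M\<^sub>F) * (u x)\<^sup>2" for m x
  proof (cases "x \<in> K")
    case True
    have "\<bar>\<alpha> * (?d - 2) * partial_potential h (?A m) x - \<alpha>\<^sup>2 * (norm (pole_field h (?A m) x))\<^sup>2\<bar>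
        \<le> \<bar>\<alpha> * (?d - 2)\<bar> * partial_potential h (?A m) x + \<alpha>\<^sup>2 * (norm (pole_field h (?A m) x))\<^sup>2"
      by (intro order_trans[OF abs_triangle_ineq4]) (simp add: abs_mult V_nonneg)
    also have "\<dots> \<le> \<bar>\<alpha> * (?d - 2)\<bar> * M\<^sub>V + \<alpha>\<^sup>2 * M\<^sub>F"
      by (intro add_mono mult_left_mono V_bound F_bound True) auto
    finally have "(u x)\<^sup>2 * \<bar>\<alpha> * (?d - 2) * partial_potential h (?A m) x - \<alpha>\<^sup>2 * (norm (pole_field h (?A m) x))\<^sup>2\<bar>
       \<le> (u x)\<^sup>2 * (\<bar>\<alpha> * (?d - 2)\<bar> * M\<^sub>V + \<alpha>\<^sup>2 * M\<^sub>F)"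
      by (intro mult_left_mono) auto
    then show ?thesis unfolding L_def real_norm_def abs_mult by (simp add: mult.commute)
  qed (simp add: u0 L_def)

  have Vu_meas [measurable]: "(\<lambda>x. potential h x * (u x)\<^sup>2) \<in> borel_measurable lborel"
    by (rule borel_measurable_LIMSEQ_real[OF Vu_lim]) measurable
  have Lm_meas [measurable]: "L m \<in> borel_measurable lborel" for m
    unfolding L_def by measurable
  have L_meas [measurable]: "Llim \<in> borel_measurable lborel"
    by (rule borel_measurable_LIMSEQ_real[OF L_lim]) measurable
  have int_Vu: "integrable lborel (\<lambda>x. potential h x * (u x)\<^sup>2)"
    by (rule integrable_dominated_convergence[OF Vu_meas _ int_u2 AE_I2[OF Vu_lim] AE_I2[OF Vu_bound]]) measurable
  have int_Lm: "integrable lborel (L m)" for m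
    by (rule integrable_dominated_convergence2[OF L_meas Lm_meas int_u2 AE_I2[OF L_lim] AE_I2[OF L_bound]])
  have int_L: "integrable lborel Llim"
    by (rule integrable_dominated_convergence[OF L_meas Lm_meas int_u2 AE_I2[OF L_lim] AE_I2[OF L_bound]])
  have lim_int_L: "(\<lambda>m. LINT x|lborel. L m x) \<longlonglongrightarrow> (LINT x|lborel. Llim x)"
    by (rule integral_dominated_convergence[OF L_meas Lm_meas int_u2 AE_I2[OF L_lim] AE_I2[OF L_bound]])

  \<comment> \<open>Expand \<open>(norm (grad u + \<alpha> u F))\<^sup>2 \<ge> 0\<close> with \<open>F\<close> the pole field, and integrate the
      cross term by parts.\<close>
  have step: "(LINT x|lborel. L m x) \<le> (LINT x|lborel. (norm (grad u x))\<^sup>2)" for m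
  proof -
    let ?D = "\<lambda>x. 2 * u x * (grad u x \<bullet> pole_field h (?A m) x)
      + (?d - 2) * (u x)\<^sup>2 * partial_potential h (?A m) x"
    note div = integral_divergence_multipole_field[OF u K u0 Kpole, of "?A m"]
    have pointwise: "L m x \<le> (norm (grad u x))\<^sup>2 + \<alpha> * ?D x" for x
    proof -
      have "0 \<le> (norm (grad u x + (\<alpha> * u x) *\<^sub>R pole_field h (?A m) x))\<^sup>2" by simp
      also have "\<dots> = (norm (grad u x))\<^sup>2 + 2 * \<alpha> * u x * (grad u x \<bullet> pole_field h (?A m) x)
          + \<alpha>\<^sup>2 * (u x)\<^sup>2 * (norm (pole_field h (?A m) x))\<^sup>2"
        unfolding power2_norm_eq_inner by (simp add: inner_add inner_commute power2_eq_square)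
      finally show ?thesis unfolding L_def by (simp add: algebra_simps)
    qed
    have "(LINT x|lborel. L m x) \<le> (LINT x|lborel. (norm (grad u x))\<^sup>2 + \<alpha> * ?D x)"
      by (intro integral_mono int_Lm Bochner_Integration.integrable_add int_grad
          integrable_mult_right div(1) pointwise)
    also have "\<dots> = (LINT x|lborel. (norm (grad u x))\<^sup>2)"
      using int_grad div by simp
    finally show ?thesis .
  qed
  have main: "(LINT x|lborel. Llim x) \<le> (LINT x|lborel. (norm (grad u x))\<^sup>2)"
    by (rule LIMSEQ_le_const2[OF lim_int_L]) (use step in auto)

  have pointwise_Llim: "(?d - 2)\<^sup>2 / (4 * \<kappa>) * (potential h x * (u x)\<^sup>2) \<le> Llim x" for x
  proof (cases "x \<in> K")
    case True
    have "infdist x diagonal \<le> R" using cylI[OF True] by (simp add: cylinder_def)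
    then have "sqrt ?d * infdist x diagonal \<le> sqrt ?d * R"
      by (intro mult_left_mono) auto
    from order_trans[OF Im_axial_coord_le_infdist this] have "Im (?z x) \<le> R * sqrt ?d"
      by (simp only: mult.commute)
    then have "(norm (?cot x))\<^sup>2 \<le> \<kappa> * lattice_sum (?z x)"
      unfolding \<kappa>_def using assms(3)
      by (intro pi_cot_sq_le_lattice_sum znI True Im_axial_coord_nonneg) auto
    then have "\<alpha>\<^sup>2 * (?d * (norm (?cot x))\<^sup>2) \<le> \<alpha>\<^sup>2 * (?d * (\<kappa> * lattice_sum (?z x)))"
      by (intro mult_left_mono) auto
    also have "\<dots> = \<alpha>\<^sup>2 * \<kappa> * potential h x"
      unfolding potential_eq[OF h] by simp
    finally have "(\<alpha> * (?d - 2) - \<alpha>\<^sup>2 * \<kappa>) * potential h x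
        \<le> \<alpha> * (?d - 2) * potential h x - \<alpha>\<^sup>2 * (?d * (norm (?cot x))\<^sup>2)"
      by (simp add: algebra_simps)
    then have "(u x)\<^sup>2 * ((\<alpha> * (?d - 2) - \<alpha>\<^sup>2 * \<kappa>) * potential h x) \<le> Llim x"
      unfolding Llim_def by (intro mult_left_mono) auto
    also have "\<alpha> * (?d - 2) - \<alpha>\<^sup>2 * \<kappa> = (?d - 2)\<^sup>2 / (4 * \<kappa>)"
      unfolding \<alpha>_def using \<kappa> by (simp add: power2_eq_square field_simps)
    finally show ?thesis by (simp add: mult_ac)
  qed (simp add: u0 Llim_def)
  have "(?d - 2)\<^sup>2 / (4 * \<kappa>) * (LINT x|lborel. potential h x * (u x)\<^sup>2)
      = (LINT x|lborel. (?d - 2)\<^sup>2 / (4 * \<kappa>) * (potential h x * (u x)\<^sup>2))"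
    by simp
  also have "\<dots> \<le> (LINT x|lborel. Llim x)"
    by (intro integral_mono integrable_mult_right int_Vu int_L pointwise_Llim)
  also note main
  finally have "(?d - 2)\<^sup>2 / (4 * \<kappa>) * (LINT x|lborel. potential h x * (u x)\<^sup>2)
      \<le> (LINT x|lborel. (norm (grad u x))\<^sup>2)" .
  moreover have "(LINT x:cylinder R|lborel. f x) = (LINT x|lborel. f x)"
    if "\<And>x. x \<notin> K \<Longrightarrow> f x = 0" for f :: "real ^ 'n \<Rightarrow> real"
    unfolding set_lebesgue_integral_def
    by (intro Bochner_Integration.integral_cong refl) (metis cylI indicator_simps(1) scaleR_one scaleR_zero_right that)
  ultimately show ?thesis by (simp add: u0 g0 \<kappa>_def mult_ac)
qed

end
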